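(* If $\mathrm{cov}(\mathcal M)<\mathfrak d$, then there is a regular topological space $X$ that is a Menger space and does not satisfy $\mathsf S_1(\mathcal K_X,\mathcal O_X)$.
   Context: $\mathrm{cov}(\mathcal M)$ is the least cardinality of a family of meager subsets of the real line $\mathbb R$ whose union is $\mathbb R$; $\mathfrak d$ is the dominating number, i.e. the least cardinality of a family $D\subseteq\omega^\omega$ such that every $f\in\omega^\omega$ is eventually dominated by some $g\in D$ (that is, $f(n)\le g(n)$ for all but finitely many $n$). A topological space $X$ is a Menger space if, for every sequence $(\mathcal U_n)_{n\in\omega}$ of open covers of $X$, there is a sequence $(\mathcal F_n)_{n\in\omega}$ such that each $\mathcal F_n$ is a finite subset of $\mathcal U_n$ and $\bigcup_{n\in\omega}\mathcal F_n$ covers $X$. $\mathcal O_X$ is the family of all open covers of $X$. A $k$-cover of $X$ is an open cover $\mathcal U$ of $X$ such that every compact subset of $X$ is included in some element of $\mathcal U$; $\mathcal K_X$ is the family of all $k$-covers of $X$. $\mathsf S_1(\mathcal A,\mathcal B)$ is the statement: for every sequence $(A_n)_{n\in\omega}$ of elements of $\mathcal A$ there is a sequence $(B_n)_{n\in\omega}$ with $B_n\in A_n$ for each $n\in\omega$ and $\{B_n:n\in\omega\}\in\mathcal B$. *)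

theory Defs
  imports "HOL-Analysis.Analysis"
begin

unbundle cardinal_syntax

text \<open>Cardinals are represented, as in the library, by cardinal orders compared with \<open>\<le>o\<close> and
  \<open><o\<close>. The cardinal \<open>least_card P\<close> is \<open>|A|\<close> for some \<open>A\<close> of least cardinality satisfying \<open>P\<close>;
  it is only meaningful if some set satisfies \<open>P\<close>, see the lemma below.\<close>

definition least_card :: "('a set \<Rightarrow> bool) \<Rightarrow> 'a rel" where
  "least_card P = |SOME A. P A \<and> (\<forall>B. P B \<longrightarrow> |A| \<le>o |B| )|"

lemma least_card:
  assumes "P C"
  shows "\<exists>A. P A \<and> least_card P = |A|" and "P B \<Longrightarrow> least_card P \<le>o |B|"
proof -
  have "\<exists>r\<in>{|A| |A. P A}. \<forall>r'\<in>{|A| |A. P A}. r \<le>o r'"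
    using assms by (intro exists_minim_Card_order) (auto simp: card_of_Card_order)
  then have "\<exists>A. P A \<and> (\<forall>B. P B \<longrightarrow> |A| \<le>o |B| )"
    by blast
  from someI_ex[OF this]
  show "\<exists>A. P A \<and> least_card P = |A|" and "P B \<Longrightarrow> least_card P \<le>o |B|"
    unfolding least_card_def by blast+
qed

definition nowhere_dense :: "'a::topological_space set \<Rightarrow> bool" where
  "nowhere_dense S \<longleftrightarrow> interior (closure S) = {}"

definition meager :: "'a::topological_space set \<Rightarrow> bool" where
  "meager S \<longleftrightarrow> (\<exists>\<N>. countable \<N> \<and> (\<forall>N\<in>\<N>. nowhere_dense N) \<and> S = \<Union>\<N>)"

definition cov_meager :: "real set rel" where
  "cov_meager = least_card (\<lambda>\<F>. (\<forall>M\<in>\<F>. meager M) \<and> \<Union>\<F> = UNIV)"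

definition dominating :: "(nat \<Rightarrow> nat) set \<Rightarrow> bool" where
  "dominating D \<longleftrightarrow> (\<forall>f. \<exists>g\<in>D. \<forall>\<^sub>F n in sequentially. f n \<le> g n)"

definition dominating_number :: "(nat \<Rightarrow> nat) rel" where
  "dominating_number = least_card dominating"

lemma meager_cover_exists: "\<exists>\<F>. (\<forall>M\<in>\<F>. meager (M :: real set)) \<and> \<Union>\<F> = UNIV"
proof (intro exI conjI ballI)
  show "\<Union>(range (\<lambda>x::real. {x})) = UNIV"
    by auto
next
  fix M assume "M \<in> range (\<lambda>x::real. {x})"
  then show "meager M"
    unfolding meager_def nowhere_dense_def by (intro exI[of _ "{M}"]) auto
qed

lemma dominating_UNIV: "dominating UNIV"
  unfolding dominating_def by (metis UNIV_I always_eventually order_refl)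

definition open_covers :: "'a topology \<Rightarrow> 'a set set set" where
  "open_covers X = {\<U>. (\<forall>U\<in>\<U>. openin X U) \<and> \<Union>\<U> = topspace X}"

definition k_covers :: "'a topology \<Rightarrow> 'a set set set" where
  "k_covers X = {\<U> \<in> open_covers X. \<forall>K. compactin X K \<longrightarrow> (\<exists>U\<in>\<U>. K \<subseteq> U)}"

definition Menger_space :: "'a topology \<Rightarrow> bool" where
  "Menger_space X \<longleftrightarrow>
    (\<forall>\<U>. (\<forall>n::nat. \<U> n \<in> open_covers X) \<longrightarrow>
      (\<exists>\<F>. (\<forall>n. finite (\<F> n) \<and> \<F> n \<subseteq> \<U> n) \<and> \<Union>(\<Union>n. \<F> n) = topspace X))"

definition S1 :: "'b set set \<Rightarrow> 'b set set \<Rightarrow> bool" where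
  "S1 \<A> \<B> \<longleftrightarrow>
    (\<forall>A. (\<forall>n::nat. A n \<in> \<A>) \<longrightarrow> (\<exists>B. (\<forall>n. B n \<in> A n) \<and> range B \<in> \<B>))"

end

theory Submission
  imports Defs
begin

text \<open>
  The space is (a copy on the real line of) a set \<open>F\<close> of functions \<open>nat \<Rightarrow> nat\<close>, as a subspace of the
  Baire space, such that \<open>|F| < \<dd>\<close> and no single \<open>g\<close> agrees infinitely often with every member of \<open>F\<close>.

  Such an \<open>F\<close> of size at most \<open>cov(\<M>)\<close> comes from Bartoszynski's argument
  (\<open>small_meager_cover_guessing\<close>). Each meager set \<open>M\<close> is evaded by every binary expansion that
  infinitely often reads a certain string \<open>h n\<close> at position \<open>n\<close> (\<open>meager_evaded\<close>). Since there are fewer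
  than \<open>\<dd>\<close> sets \<open>M\<close>, one partition of the positions into blocks has, for each \<open>M\<close>, infinitely many
  blocks that start with a string of \<open>M\<close> (\<open>small_imp_gap_sequence\<close>). Let \<open>f M k\<close> list the first \<open>k + 1\<close> of
  these blocks with their strings. A guess \<open>g\<close> that is right infinitely often for every \<open>M\<close> would offer
  at stage \<open>k\<close> so many blocks that one is not used yet; filling it in at each stage builds a real
  number outside every \<open>M\<close>, so the sets \<open>M\<close> would not cover the line.

  The Menger property holds for every Lindelof space with fewer than \<open>\<dd>\<close> points
  (\<open>small_Lindelof_imp_Menger\<close>). Moreover \<open>|F| < \<dd> \<le> \<cc>\<close>, so by the perfect set theorem all compact subsets of
  the space are countable (\<open>small_compact_imp_countable\<close>). Hence the unions of finitely many sets
  \<open>{f. f j = c j}\<close>, for \<open>j\<close> in a fixed infinite set of indices, form a k-cover: its members can follow an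
  enumeration of the compact set. A selection from k-covers belonging to disjoint index sets fixes
  one value \<open>g j\<close> for each index \<open>j\<close>, so that \<open>S1\<close> would produce a \<open>g\<close> which agrees infinitely often with
  every member of \<open>F\<close> (\<open>S1_imp_infinitely_often_equal\<close>).
\<close>

section \<open>Fewer functions than the dominating number\<close>

lemma small_not_dominating:
  fixes \<Phi> :: "(nat \<Rightarrow> nat) set"
  assumes "|\<Phi>| <o dominating_number"
  obtains \<psi> where "\<And>\<phi>. \<phi> \<in> \<Phi> \<Longrightarrow> \<exists>\<^sub>F n in sequentially. \<phi> n < \<psi> n"
proof -
  have "\<not> dominating \<Phi>"
    using least_card(2)[where P = dominating, OF dominating_UNIV] assms not_ordLess_ordLeq
    unfolding dominating_number_def by blast
  then show ?thesis
    using that by (auto simp: dominating_def not_eventually not_le)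
qed

text \<open>
  Iterating one function \<open>\<psi>\<close> gives the sequence. It is not enough that \<open>\<phi> n < \<psi> n\<close> for infinitely many \<open>n\<close>,
  since such \<open>n\<close> need not occur in the sequence. If \<open>\<phi>\<close> jumps over the next term from all late
  terms, then two applications of \<open>\<phi>\<close> lead from any late \<open>n\<close> beyond \<open>\<psi> n\<close>; so \<open>\<psi>\<close> is chosen undominated
  by the squares \<open>\<phi> \<circ> \<phi>\<close>, after making every \<open>\<phi>\<close> monotone.
\<close>

lemma small_imp_gap_sequence:
  fixes \<Phi> :: "(nat \<Rightarrow> nat) set"
  assumes "|\<Phi>| <o dominating_number"
  obtains a where "strict_mono a" "\<And>\<phi>. \<phi> \<in> \<Phi> \<Longrightarrow> infinite {i. \<phi> (a i) \<le> a (Suc i)}"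
proof -
  define maj :: "(nat \<Rightarrow> nat) \<Rightarrow> nat \<Rightarrow> nat" where "maj \<phi> n = n + (\<Sum>m\<le>n. \<phi> m)" for \<phi> n
  have maj_mono: "maj \<phi> m \<le> maj \<phi> n" if "m \<le> n" for \<phi> m n
    unfolding maj_def using that by (intro add_mono sum_mono2) auto
  have maj_ge: "\<phi> n \<le> maj \<phi> n" for \<phi> n
    unfolding maj_def by (rule trans_le_add2) (rule member_le_sum, auto)
  have "|(\<lambda>\<phi>. maj \<phi> \<circ> maj \<phi>) ` \<Phi>| <o dominating_number"
    using card_of_image assms ordLeq_ordLess_trans by blast
  then obtain \<psi>0 where
    "\<And>\<eta>. \<eta> \<in> (\<lambda>\<phi>. maj \<phi> \<circ> maj \<phi>) ` \<Phi> \<Longrightarrow> \<exists>\<^sub>F n in sequentially. \<eta> n < \<psi>0 n"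
    by (rule small_not_dominating) blast
  then have \<psi>0: "\<exists>\<^sub>F n in sequentially. maj \<phi> (maj \<phi> n) < \<psi>0 n" if "\<phi> \<in> \<Phi>" for \<phi>
    using that by fastforce
  define \<psi> where "\<psi> n = Suc (maj \<psi>0 n)" for n
  have \<psi>_mono: "\<psi> m \<le> \<psi> n" if "m \<le> n" for m n
    using maj_mono[OF that] by (simp add: \<psi>_def)
  define a where "a i = (\<psi> ^^ i) 0" for i
  have a0: "a 0 = 0" and a_Suc: "a (Suc i) = \<psi> (a i)" for i
    by (simp_all add: a_def)
  have a: "strict_mono a"
    by (rule strict_mono_Suc_iff[THEN iffD2]) (auto simp: a_Suc \<psi>_def maj_def)
  show ?thesis
  proof (rule that[OF a])
    fix \<phi> assume "\<phi> \<in> \<Phi>"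
    show "infinite {i. \<phi> (a i) \<le> a (Suc i)}"
    proof
      assume "finite {i. \<phi> (a i) \<le> a (Suc i)}"
      then obtain i0 where i0: "\<And>i. \<phi> (a i) \<le> a (Suc i) \<Longrightarrow> i < i0"
        by (metis (mono_tags, lifting) finite_nat_set_iff_bounded mem_Collect_eq)
      obtain n where n: "a i0 \<le> n" "maj \<phi> (maj \<phi> n) < \<psi>0 n"
        using \<psi>0[OF \<open>\<phi> \<in> \<Phi>\<close>] by (auto simp: frequently_sequentially)
      obtain i where i: "a i \<le> n" "n < a (Suc i)"
      proof -
        have "\<exists>i. n < a i"
          using strict_mono_imp_increasing[OF a, of "Suc n"] by (metis Suc_le_lessD)
        then obtain j where j: "n < a j" "\<forall>i<j. \<not> n < a i"
          using exists_least_iff[of "\<lambda>i. n < a i"] by blast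
        then obtain i where "j = Suc i"
          using a0 by (cases j) auto
        then show ?thesis
          using j that by (auto simp: not_less)
      qed
      have "i0 \<le> i"
        using n(1) i(2) strict_mono_less[OF a] by (meson le_less_trans less_Suc_eq_le)
      then have less: "a (Suc j) < \<phi> (a j)" if "j \<ge> i" for j
        using i0[of j] that by (meson le_trans not_le)
      have "\<psi>0 n \<le> \<psi> n"
        using maj_ge[of \<psi>0 n] by (simp add: \<psi>_def)
      also have "\<dots> \<le> a (Suc (Suc i))"
        using \<psi>_mono[of n "a (Suc i)"] i(2) by (simp add: a_Suc)
      also have "\<dots> < \<phi> (a (Suc i))"
        using less by simp
      also have "\<dots> \<le> maj \<phi> (a (Suc i))"
        by (rule maj_ge)
      also have "\<dots> \<le> maj \<phi> (maj \<phi> n)"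
        using less[of i] maj_ge[of \<phi> "a i"] maj_mono[OF i(1), of \<phi>]
        by (intro maj_mono) linarith
      finally show False
        using n(2) by simp
    qed
  qed
qed

section \<open>Evading meager sets by binary expansions\<close>

fun dyadic_left :: "bool list \<Rightarrow> real" where
  "dyadic_left [] = 0"
| "dyadic_left (b # s) = (of_bool b + dyadic_left s) / 2"

definition dyadic :: "bool list \<Rightarrow> real set" where
  "dyadic s = {dyadic_left s .. dyadic_left s + (1/2) ^ length s}"

lemma dyadic_left_append:
  "dyadic_left (s @ t) = dyadic_left s + (1/2) ^ length s * dyadic_left t"
  by (induction s) (auto simp: field_simps)

lemma dyadic_left_bounds: "0 \<le> dyadic_left s" "dyadic_left s + (1/2) ^ length s \<le> 1"
proof (induction s)
  case (Cons b s)
  have "dyadic_left (b # s) + (1/2) ^ length (b # s) =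
      (of_bool b + (dyadic_left s + (1/2) ^ length s)) / 2"
    by (simp add: field_simps)
  also have "\<dots> \<le> (1 + 1) / 2"
    by (intro divide_right_mono add_mono Cons) auto
  finally show "dyadic_left (b # s) + (1/2) ^ length (b # s) \<le> 1"
    by simp
  show "0 \<le> dyadic_left (b # s)"
    using Cons(1) by simp
qed auto

lemma dyadic_append_subset: "dyadic (s @ t) \<subseteq> dyadic s"
proof -
  have "(1/2) ^ length s * (dyadic_left t + (1/2) ^ length t) \<le> (1/2) ^ length s * (1 :: real)"
    by (intro mult_left_mono dyadic_left_bounds) auto
  then show ?thesis
    using dyadic_left_bounds(1)[of t]
    by (auto simp: dyadic_def dyadic_left_append power_add algebra_simps intro: add_increasing2)
qed

lemma dyadic_split: "dyadic s = dyadic (s @ [False]) \<union> dyadic (s @ [True])"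
proof -
  define w :: real where "w = (1/2) ^ length s"
  have "0 \<le> w"
    by (simp add: w_def)
  moreover have "dyadic (s @ [b]) =
      {dyadic_left s + w * (of_bool b / 2) .. dyadic_left s + w * (of_bool b / 2) + w / 2}" for b
    by (simp add: dyadic_def dyadic_left_append w_def)
  moreover have "dyadic s = {dyadic_left s .. dyadic_left s + w}"
    by (simp add: dyadic_def w_def)
  ultimately show ?thesis
    by auto
qed

lemma dyadic_cover:
  assumes "x \<in> dyadic s"
  obtains t where "length t = n" "x \<in> dyadic (s @ t)"
proof -
  have "\<exists>t. length t = n \<and> x \<in> dyadic (s @ t)"
  proof (induction n)
    case (Suc n)
    then obtain t where "length t = n" "x \<in> dyadic (s @ t)"
      by blast
    then show ?case
      using dyadic_split[of "s @ t"] by (metis UnE append_assoc length_append_singleton)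
  qed (use assms in simp)
  then show ?thesis
    using that by blast
qed

lemma nowhere_dense_avoid:
  assumes "nowhere_dense N"
  obtains t where "dyadic (s @ t) \<inter> N = {}"
proof -
  define W where "W = {dyadic_left s <..< dyadic_left s + (1/2) ^ length s} - closure N"
  have "open W"
    unfolding W_def by (intro open_Diff) auto
  have "W \<noteq> {}"
  proof
    assume "W = {}"
    then have "{dyadic_left s <..< dyadic_left s + (1/2) ^ length s} \<subseteq> interior (closure N)"
      unfolding W_def by (intro interior_maximal) auto
    then have "{dyadic_left s <..< dyadic_left s + (1/2) ^ length s} = {}"
      using assms by (simp only: nowhere_dense_def subset_empty)
    moreover have "(0 :: real) < (1/2) ^ length s"
      by simp
    ultimately show False
      unfolding greaterThanLessThan_empty_iff by linarith
  qed
  then obtain x e where x: "x \<in> W" "e > 0" "ball x e \<subseteq> W"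
    using \<open>open W\<close> by (meson ex_in_conv open_contains_ball)
  obtain n where n: "(1/2 :: real) ^ n < e"
    using real_arch_pow_inv[OF \<open>e > 0\<close>] by (metis divide_less_eq_1_pos one_less_numeral_iff semiring_norm(76) zero_less_numeral)
  obtain t where t: "length t = n" "x \<in> dyadic (s @ t)"
    using x(1) by (auto simp: W_def dyadic_def intro: dyadic_cover[of x s n])
  have "(1/2 :: real) ^ length (s @ t) \<le> (1/2) ^ n"
    using t(1) by (intro power_decreasing) auto
  also note n
  finally have "dyadic (s @ t) \<subseteq> ball x e"
    using t(2) by (auto simp: dyadic_def dist_real_def)
  then have "dyadic (s @ t) \<inter> N = {}"
    using x(3) closure_subset[of N] by (auto simp: W_def)
  then show ?thesis
    by (rule that)
qed

text \<open>
  One suffix serves finitely many prefixes at once: extending a suffix keeps what it has achieved.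
\<close>

lemma nowhere_dense_avoid_finite:
  assumes "finite P" "\<And>s N. (s, N) \<in> P \<Longrightarrow> nowhere_dense N"
  shows "\<exists>t. \<forall>(s, N) \<in> P. dyadic (s @ t) \<inter> N = {}"
  using assms
proof (induction P rule: finite_induct)
  case (insert q P)
  obtain s N where q: "q = (s, N)"
    by (cases q)
  obtain t where t: "\<forall>(s, N) \<in> P. dyadic (s @ t) \<inter> N = {}"
    using insert by auto
  obtain u where u: "dyadic ((s @ t) @ u) \<inter> N = {}"
    using insert.prems q by (blast intro: nowhere_dense_avoid)
  have "\<forall>(s, N) \<in> insert q P. dyadic (s @ t @ u) \<inter> N = {}"
    using t u q dyadic_append_subset[of "_ @ t" u] by fastforce
  then show ?case
    by blast
qed auto

definition realizes :: "(nat \<Rightarrow> bool) \<Rightarrow> nat \<Rightarrow> bool list \<Rightarrow> bool" where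
  "realizes z n t \<longleftrightarrow> (\<forall>i<length t. z (n + i) = t ! i)"

text \<open>
  The points \<open>x\<close> with binary expansion \<open>z\<close> are described by membership in all dyadic intervals along \<open>z\<close>.
\<close>

definition evades :: "(nat \<Rightarrow> bool list) \<Rightarrow> real set \<Rightarrow> bool" where
  "evades h M \<longleftrightarrow> (\<forall>z x. infinite {n. realizes z n (h n)} \<longrightarrow>
     (\<forall>n. x \<in> dyadic (map z [0..<n])) \<longrightarrow> x \<notin> M)"

text \<open>
  There are only finitely many strings of length \<open>n\<close>, so a single string \<open>h n\<close> can be chosen that leads
  out of the first \<open>n + 1\<close> nowhere dense pieces of \<open>M\<close>, whatever precedes it.
\<close>

lemma meager_evaded:
  assumes "meager M"
  shows "\<exists>h. evades h M"
proof -
  obtain \<N> where \<N>: "countable \<N>" "\<And>N. N \<in> \<N> \<Longrightarrow> nowhere_dense N" "M = \<Union>\<N>"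
    using assms by (auto simp: meager_def)
  \<comment> \<open>The empty set is added because an empty family has no enumeration.\<close>
  define N where "N = from_nat_into (insert {} \<N>)"
  have N: "nowhere_dense (N j)" for j
    using from_nat_into[of "insert {} \<N>" j] \<N>(2) by (auto simp: N_def nowhere_dense_def)
  have "\<forall>n. \<exists>t. \<forall>s j. length s = n \<longrightarrow> j \<le> n \<longrightarrow> dyadic (s @ t) \<inter> N j = {}"
  proof
    fix n
    have "\<exists>t. \<forall>(s, A) \<in> {s. length s = n} \<times> N ` {..n}. dyadic (s @ t) \<inter> A = {}"
      using finite_lists_length_eq[of "UNIV :: bool set" n]
      by (intro nowhere_dense_avoid_finite) (auto intro: N)
    then obtain t where "\<forall>(s, A) \<in> {s. length s = n} \<times> N ` {..n}. dyadic (s @ t) \<inter> A = {}"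
      by blast
    then show "\<exists>t. \<forall>s j. length s = n \<longrightarrow> j \<le> n \<longrightarrow> dyadic (s @ t) \<inter> N j = {}"
      by (intro exI[of _ t]) auto
  qed
  from choice[OF this] obtain h where
    h: "dyadic (s @ h n) \<inter> N j = {}" if "length s = n" "j \<le> n" for s n j
    by blast
  have "x \<notin> M" if z: "infinite {n. realizes z n (h n)}" and x: "\<And>n. x \<in> dyadic (map z [0..<n])" for z x
  proof
    assume "x \<in> M"
    then obtain A where A: "A \<in> \<N>" "x \<in> A"
      using \<N>(3) by blast
    then obtain j where "N j = A"
      unfolding N_def using \<N>(1) from_nat_into_surj[of "insert {} \<N>" A] by auto
    with A have j: "x \<in> N j"
      by simp
    obtain n where n: "n \<ge> j" "realizes z n (h n)"
      using z by (metis (mono_tags, lifting) infinite_nat_iff_unbounded_le mem_Collect_eq)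
    have "map z [n..<n + length (h n)] = h n"
      using n(2) by (intro nth_equalityI) (auto simp: realizes_def)
    then have "map z [0..<n + length (h n)] = map z [0..<n] @ h n"
      using upt_add_eq_append[of 0 n "length (h n)"] by simp
    then show False
      using x[of "n + length (h n)"] h[of "map z [0..<n]" n j] n(1) j by auto
  qed
  then show ?thesis
    unfolding evades_def by blast
qed

lemma dyadic_point: "\<exists>x. \<forall>n. x \<in> dyadic (map z [0..<n])"
proof -
  have "\<Inter>(range (\<lambda>n. dyadic (map z [0..<n]))) \<noteq> {}"
  proof (rule compact_nest)
    fix m n :: nat assume "m \<le> n"
    then have "map z [0..<n] = map z [0..<m] @ map z [m..<n]"
      using upt_add_eq_append[of 0 m "n - m"] by simp
    then show "dyadic (map z [0..<n]) \<subseteq> dyadic (map z [0..<m])"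
      using dyadic_append_subset by metis
  qed (auto simp: dyadic_def)
  then show ?thesis
    by auto
qed

section \<open>A small family of functions that cannot be guessed\<close>

text \<open>
  At stage \<open>k\<close> the earlier stages have used up at most \<open>k\<close> elements, whereas \<open>D k\<close> has more. The choice at
  the remaining stages is arbitrary.
\<close>

lemma distinct_choice:
  fixes D :: "nat \<Rightarrow> 'a set"
  obtains p where "\<And>k. k < card (D k) \<Longrightarrow> p k \<in> D k" "inj_on p {k. k < card (D k)}"
proof -
  have "\<exists>p. \<forall>k. k < card (D k) \<longrightarrow> p k \<in> D k - p ` {..<k}"
  proof (rule dependent_wf_choice[of less_than "\<lambda>p k q. k < card (D k) \<longrightarrow> q \<in> D k - p ` {..<k}"])
    fix k and p :: "nat \<Rightarrow> 'a"
    have "card (p ` {..<k}) \<le> k"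
      using card_image_le[of "{..<k}" p] by simp
    then have "\<not> D k \<subseteq> p ` {..<k}" if "k < card (D k)"
      using card_mono[of "p ` {..<k}" "D k"] that by auto
    then show "\<exists>q. k < card (D k) \<longrightarrow> q \<in> D k - p ` {..<k}"
      by blast
  next
    fix f g :: "nat \<Rightarrow> 'a" and k q
    assume "\<And>j. (j, k) \<in> less_than \<Longrightarrow> f j = g j"
    then have "f ` {..<k} = g ` {..<k}"
      by (intro image_cong) auto
    then show "(k < card (D k) \<longrightarrow> q \<in> D k - f ` {..<k}) = (k < card (D k) \<longrightarrow> q \<in> D k - g ` {..<k})"
      by simp
  qed simp
  then obtain p where p: "\<And>k. k < card (D k) \<Longrightarrow> p k \<in> D k - p ` {..<k}"
    by blast
  have "inj_on p {k. k < card (D k)}"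
  proof (rule linorder_inj_onI)
    fix i k assume "i < k" "k \<in> {k. k < card (D k)}"
    then have "p i \<in> p ` {..<k}" "p k \<notin> p ` {..<k}"
      using p[of k] by auto
    then show "p i \<noteq> p k"
      by metis
  qed auto
  then show ?thesis
    using p that by blast
qed

text \<open>
  This is the harder half of Bartoszynski's characterisation of \<open>cov(\<M>)\<close> by infinitely often equal
  functions; the bound by \<open>\<dd>\<close> serves to use the same blocks for all members of the family.
\<close>

lemma small_meager_cover_guessing:
  assumes meager: "\<And>M. M \<in> \<F> \<Longrightarrow> meager (M :: real set)" and cover: "\<Union>\<F> = UNIV"
    and small: "|\<F>| <o dominating_number"
  obtains f :: "real set \<Rightarrow> nat \<Rightarrow> nat"
  where "\<And>g. \<exists>M\<in>\<F>. finite {k. f M k = g k}"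
proof -
  obtain h where h: "\<And>M. M \<in> \<F> \<Longrightarrow> evades (h M) M"
    using meager_evaded[OF meager] by metis
  have "|(\<lambda>M n. n + length (h M n)) ` \<F>| <o dominating_number"
    using card_of_image small ordLeq_ordLess_trans by blast
  then obtain a where a: "strict_mono a" and
    gap: "\<And>\<phi>. \<phi> \<in> (\<lambda>M n. n + length (h M n)) ` \<F> \<Longrightarrow> infinite {i. \<phi> (a i) \<le> a (Suc i)}"
    by (rule small_imp_gap_sequence) blast
  define G where "G M = {i. a i + length (h M (a i)) \<le> a (Suc i)}" for M
  have G: "infinite (G M)" if "M \<in> \<F>" for M
    using gap[of "\<lambda>n. n + length (h M n)"] that by (auto simp: G_def)
  \<comment> \<open>The list has \<open>k + 1\<close> different blocks: one more than the stages before \<open>k\<close> can have used.\<close>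
  define code where "code M k = map (\<lambda>j. let i = enumerate (G M) j in (i, h M (a i))) [0..<Suc k]" for M k
  define f where "f M k = to_nat (code M k)" for M k
  have "\<exists>M\<in>\<F>. finite {k. f M k = g k}" for g :: "nat \<Rightarrow> nat"
  proof (rule ccontr)
    assume "\<not> ?thesis"
    then have inf: "infinite {k. f M k = g k}" if "M \<in> \<F>" for M
      using that by blast
    define d :: "nat \<Rightarrow> (nat \<times> bool list) list" where "d k = from_nat (g k)" for k
    define D where "D k = fst ` set (d k)" for k
    obtain p where p: "\<And>k. k < card (D k) \<Longrightarrow> p k \<in> D k" "inj_on p {k. k < card (D k)}"
      using distinct_choice by blast
    define s where "s k = the (map_of (d k) (p k))" for k
    \<comment> \<open>The string guessed at stage \<open>k\<close> is written into the block \<open>p k\<close>; different stages use different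
      blocks, so these requirements do not conflict.\<close>
    define z where "z x \<longleftrightarrow> (\<exists>k. k < card (D k) \<and> a (p k) \<le> x \<and> x < a (Suc (p k)) \<and> s k ! (x - a (p k)))" for x
    have z: "realizes z (a (p k)) (s k)" if k: "k < card (D k)" and len: "a (p k) + length (s k) \<le> a (Suc (p k))" for k
      unfolding realizes_def
    proof (intro allI impI)
      fix r assume r: "r < length (s k)"
      have "l = k" if l: "l < card (D l)" "a (p l) \<le> a (p k) + r" "a (p k) + r < a (Suc (p l))" for l
      proof -
        have "a (p k) + r < a (Suc (p k))"
          using r len by simp
        with l have "a (p l) < a (Suc (p k))" "a (p k) < a (Suc (p l))"
          by simp_all
        then have "p l = p k"
          using strict_mono_less[OF a] by (simp add: less_Suc_eq_le)
        then show ?thesis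
          using p(2) l(1) k by (auto dest: inj_onD)
      qed
      moreover have "a (p k) + r < a (Suc (p k))"
        using r len by simp
      ultimately show "z (a (p k) + r) = s k ! r"
        using k unfolding z_def by (metis add_diff_cancel_left' le_add1)
    qed
    obtain x where x: "\<And>n. x \<in> dyadic (map z [0..<n])"
      using dyadic_point by blast
    have "x \<notin> M" if M: "M \<in> \<F>" for M
    proof -
      define K where "K = {k. f M k = g k}"
      have K: "k < card (D k)" "p k \<in> G M" "s k = h M (a (p k))" if "k \<in> K" for k
      proof -
        have "g k = to_nat (code M k)"
          using that by (simp add: K_def f_def)
        then have d: "d k = code M k"
          by (simp add: d_def)
        have Dk: "D k = enumerate (G M) ` {..<Suc k}"
          unfolding D_def d code_def by (simp add: Let_def image_image atLeast0LessThan del: upt_Suc)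
        have "inj (enumerate (G M))"
          using strict_mono_enumerate[OF G[OF M]] strict_mono_imp_inj_on by blast
        then have "card (D k) = Suc k"
          unfolding Dk by (subst card_image) (auto intro: inj_on_subset)
        then show k: "k < card (D k)"
          by simp
        have pk: "p k \<in> D k"
          by (rule p(1)[OF k])
        then show "p k \<in> G M"
          unfolding Dk using enumerate_in_set[OF G[OF M]] by auto
        have "s k = y" if "map_of (d k) (p k) = Some y" for y
          using that by (simp add: s_def)
        moreover obtain y where y: "map_of (d k) (p k) = Some y"
          using pk map_of_eq_None_iff[of "d k" "p k"] by (auto simp: D_def)
        moreover have "y = h M (a (p k))"
          using map_of_SomeD[OF y] unfolding d code_def by (auto simp: Let_def)
        ultimately show "s k = h M (a (p k))"
          by simp
      qed
      have "realizes z (a (p k)) (h M (a (p k)))" if "k \<in> K" for k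
        using z[of k] K[OF that] by (simp add: G_def)
      then have "(a \<circ> p) ` K \<subseteq> {n. realizes z n (h M n)}"
        by auto
      moreover have "inj_on (a \<circ> p) K"
        using K(1) inj_on_subset[OF p(2), of K] strict_mono_imp_inj_on[OF a]
        by (intro comp_inj_on) (auto intro: inj_on_subset)
      then have "infinite ((a \<circ> p) ` K)"
        using inf[OF M] finite_imageD unfolding K_def by blast
      ultimately have "infinite {n. realizes z n (h M n)}"
        using finite_subset by blast
      then show ?thesis
        using h[OF M] x unfolding evades_def by blast
    qed
    then show False
      using cover by blast
  qed
  then show ?thesis
    by (rule that)
qed

section \<open>Small spaces\<close>

text \<open>
  Each point \<open>x\<close> yields the function that sends \<open>n\<close> to the number of a member of the \<open>n\<close>-th countable cover
  containing \<open>x\<close>. As these functions do not dominate, a suitable \<open>\<psi>\<close> exceeds each of them somewhere,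
  and the sets with number below \<open>\<psi> n\<close> suffice.
\<close>

lemma small_Lindelof_imp_Menger:
  assumes "Lindelof_space X" and small: "|topspace X| <o dominating_number"
  shows "Menger_space X"
  unfolding Menger_space_def
proof (intro allI impI)
  fix \<U> :: "nat \<Rightarrow> 'a set set"
  assume \<U>: "\<forall>n. \<U> n \<in> open_covers X"
  have "\<exists>\<V>. countable \<V> \<and> \<V> \<subseteq> \<U> n \<and> \<Union>\<V> = topspace X" for n
    using \<U> by (intro Lindelof_spaceD[OF assms(1)]) (auto simp: open_covers_def)
  then obtain \<V> where \<V>: "\<And>n. countable (\<V> n)" "\<And>n. \<V> n \<subseteq> \<U> n" "\<And>n. \<Union>(\<V> n) = topspace X"
    by metis
  define \<phi> where "\<phi> x n = (SOME m. \<exists>V\<in>\<V> n. x \<in> V \<and> m = to_nat_on (\<V> n) V)" for x n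
  have \<phi>: "\<exists>V\<in>\<V> n. x \<in> V \<and> \<phi> x n = to_nat_on (\<V> n) V" if "x \<in> topspace X" for x n
  proof -
    have "\<exists>m. \<exists>V\<in>\<V> n. x \<in> V \<and> m = to_nat_on (\<V> n) V"
      using \<V>(3)[of n] that by blast
    then show ?thesis
      unfolding \<phi>_def by (rule someI_ex)
  qed
  have "|\<phi> ` topspace X| <o dominating_number"
    using card_of_image small ordLeq_ordLess_trans by blast
  then obtain \<psi> where \<psi>: "\<And>\<eta>. \<eta> \<in> \<phi> ` topspace X \<Longrightarrow> \<exists>\<^sub>F n in sequentially. \<eta> n < \<psi> n"
    by (rule small_not_dominating) blast
  define \<F> where "\<F> n = {V \<in> \<V> n. to_nat_on (\<V> n) V < \<psi> n}" for n
  have "finite (\<F> n)" for n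
  proof (rule inj_on_finite)
    show "inj_on (to_nat_on (\<V> n)) (\<F> n)"
      using \<V>(1) by (auto simp: \<F>_def intro: inj_on_subset[OF inj_on_to_nat_on])
    show "to_nat_on (\<V> n) ` \<F> n \<subseteq> {..<\<psi> n}"
      by (auto simp: \<F>_def)
  qed auto
  moreover have "\<F> n \<subseteq> \<U> n" for n
    using \<V>(2) by (auto simp: \<F>_def)
  moreover have "\<Union>(\<Union>n. \<F> n) = topspace X"
  proof
    show "\<Union>(\<Union>n. \<F> n) \<subseteq> topspace X"
      using \<V>(3) by (auto simp: \<F>_def)
    show "topspace X \<subseteq> \<Union>(\<Union>n. \<F> n)"
    proof
      fix x assume x: "x \<in> topspace X"
      then obtain n where n: "\<phi> x n < \<psi> n"
        using \<psi>[of "\<phi> x"] by (auto dest: frequently_ex)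
      obtain V where "V \<in> \<V> n" "x \<in> V" "\<phi> x n = to_nat_on (\<V> n) V"
        using \<phi>[OF x, of n] by blast
      with n have "V \<in> \<F> n" "x \<in> V"
        by (simp_all add: \<F>_def)
      then show "x \<in> \<Union>(\<Union>n. \<F> n)"
        by blast
    qed
  qed
  ultimately show "\<exists>\<F>. (\<forall>n. finite (\<F> n) \<and> \<F> n \<subseteq> \<U> n) \<and> \<Union>(\<Union>n. \<F> n) = topspace X"
    by blast
qed

lemma nat_fun_lepoll_real: "(UNIV :: (nat \<Rightarrow> nat) set) \<lesssim> (UNIV :: real set)"
proof -
  have "inj (\<lambda>f :: nat \<Rightarrow> nat. {prod_encode (n, f n) |n. True})"
  proof (rule injI, rule ext)
    fix f g :: "nat \<Rightarrow> nat" and n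
    assume "{prod_encode (n, f n) |n. True} = {prod_encode (n, g n) |n. True}"
    then have "prod_encode (n, f n) \<in> {prod_encode (n, g n) |n. True}"
      by blast
    then show "f n = g n"
      by auto
  qed
  then have "(UNIV :: (nat \<Rightarrow> nat) set) \<lesssim> (UNIV :: nat set set)"
    unfolding lepoll_def by blast
  then show ?thesis
    using nat_sets_eqpoll_reals lepoll_trans2 by blast
qed

text \<open>
  Removing all basic open sets that meet \<open>K\<close> in a countable set leaves the condensation points of
  \<open>K\<close>. They form a perfect set, which would have the cardinality of the continuum if it were nonempty.
\<close>

lemma small_compact_imp_countable:
  assumes X: "second_countable X" "Hausdorff_space X" and K: "compactin X K"
    and small: "\<not> (UNIV :: real set) \<lesssim> K"
  shows "countable K"
proof -
  obtain \<B> where \<B>: "countable \<B>" "\<And>V. V \<in> \<B> \<Longrightarrow> openin X V"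
    "\<And>U x. openin X U \<Longrightarrow> x \<in> U \<Longrightarrow> \<exists>V\<in>\<B>. x \<in> V \<and> V \<subseteq> U"
    using X(1) unfolding second_countable_def by metis
  define W where "W = \<Union>{V \<in> \<B>. countable (K \<inter> V)}"
  have W: "openin X W" "countable (K \<inter> W)"
  proof -
    show "openin X W"
      unfolding W_def using \<B>(2) by blast
    have "K \<inter> W = (\<Union>V\<in>{V \<in> \<B>. countable (K \<inter> V)}. K \<inter> V)"
      by (auto simp: W_def)
    also have "countable \<dots>"
      using \<B>(1) by (intro countable_UN) auto
    finally show "countable (K \<inter> W)" .
  qed
  define P where "P = K - W"
  have K_sub: "K \<subseteq> topspace X"
    using K by (rule compactin_subset_topspace)
  have "closedin X K"
    using compactin_imp_closedin X(2) K by blast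
  then have P: "closedin X P" "compactin X P"
    using K W(1) closed_compactin[of X K P] closedin_diff unfolding P_def by blast+
  have "P = {}"
  proof (rule ccontr)
    assume "P \<noteq> {}"
    have "x \<in> X derived_set_of P" if x: "x \<in> P" for x
      unfolding in_derived_set_of
    proof (intro conjI allI impI)
      show "x \<in> topspace X"
        using x K_sub by (auto simp: P_def)
      fix T assume T: "x \<in> T \<and> openin X T"
      then obtain V where V: "V \<in> \<B>" "x \<in> V" "V \<subseteq> T"
        using \<B>(3) by blast
      then have "\<not> countable (K \<inter> V)"
        using x by (auto simp: P_def W_def)
      moreover have "countable (K \<inter> W \<union> {x})"
        using W(2) by simp
      ultimately have "\<not> K \<inter> V \<subseteq> K \<inter> W \<union> {x}"
        using countable_subset by blast
      then show "\<exists>y. y \<noteq> x \<and> y \<in> P \<and> y \<in> T"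
        using V by (auto simp: P_def)
    qed
    then have eq: "X derived_set_of P = P"
      using P(1) closedin_contains_derived_set[of X P] by blast
    let ?Y = "subtopology X P"
    have top: "topspace ?Y = P"
      using K_sub by (auto simp: P_def)
    have "compact_space ?Y"
      using P(2) by (simp add: compact_space_subtopology)
    moreover have "Hausdorff_space ?Y"
      using X(2) by (rule Hausdorff_space_subtopology)
    moreover have "?Y derived_set_of P = P"
      by (simp add: derived_set_of_subtopology eq)
    ultimately have "(UNIV :: real set) \<lesssim> P"
      using \<open>P \<noteq> {}\<close> by (intro lepoll_perfect_set[of ?Y]) (auto intro: compact_imp_locally_compact_space)
    then have "(UNIV :: real set) \<lesssim> K"
      using subset_imp_lepoll[of P K] lepoll_trans unfolding P_def by blast
    then show False
      using small by simp
  qed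
  then have "K = K \<inter> W"
    by (auto simp: P_def)
  then show ?thesis
    using W(2) by simp
qed

section \<open>Selections from k-covers\<close>

text \<open>
  The points of \<open>X\<close> are regarded as functions through \<open>v\<close>. The indices are split into infinitely many
  infinite sets, numbered by pairs \<open>(m, n)\<close>, each carrying a k-cover. For every fixed \<open>m\<close> the covers
  \<open>C m n\<close> are subjected to \<open>S1\<close> separately: a single application would give only one
  agreement with \<open>g\<close> for each point, but now there is one for each \<open>m\<close>.
\<close>

lemma S1_imp_infinitely_often_equal:
  fixes v :: "'a \<Rightarrow> nat \<Rightarrow> nat"
  assumes S1: "S1 (k_covers X) (open_covers X)"
    and countable: "\<And>K. compactin X K \<Longrightarrow> countable K"
    and opn: "\<And>n c. openin X {x \<in> topspace X. v x n = c}"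
  obtains g where "\<And>x. x \<in> topspace X \<Longrightarrow> infinite {n. v x n = g n}"
proof -
  define e where "e m n j = prod_encode (m, prod_encode (n, j))" for m n j :: nat
  define agree where "agree m n S c = {x \<in> topspace X. \<exists>j\<in>S. v x (e m n j) = c j}" for m n and S :: "nat set" and c
  define C where "C m n = {agree m n S c |S c. finite S}" for m n
  have open_agree: "openin X (agree m n S c)" for m n S c
  proof -
    have "agree m n S c = (\<Union>j\<in>S. {x \<in> topspace X. v x (e m n j) = c j})"
      by (auto simp: agree_def)
    then show ?thesis
      using opn by auto
  qed
  have compact: "\<exists>U\<in>C m n. K \<subseteq> U" if K: "compactin X K" for m n K
  proof (cases "K = {}")
    case True
    then show ?thesis
      unfolding C_def by blast
  next
    case False
    \<comment> \<open>The \<open>j\<close>-th index takes care of the \<open>j\<close>-th point of \<open>K\<close>.\<close>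
    define c where "c j = v (from_nat_into K j) (e m n j)" for j
    have "K \<subseteq> (\<Union>j. agree m n {j} c)"
    proof
      fix x assume x: "x \<in> K"
      then obtain j where "from_nat_into K j = x"
        using from_nat_into_surj[OF countable[OF K]] by blast
      then have "x \<in> agree m n {j} c"
        using x compactin_subset_topspace[OF K] by (auto simp: agree_def c_def)
      then show "x \<in> (\<Union>j. agree m n {j} c)"
        by blast
    qed
    moreover have "openin X W" if "W \<in> range (\<lambda>j. agree m n {j} c)" for W
      using that open_agree by auto
    ultimately obtain \<W> where \<W>: "finite \<W>" "\<W> \<subseteq> range (\<lambda>j. agree m n {j} c)" "K \<subseteq> \<Union>\<W>"
      using compactinD[OF K, of "range (\<lambda>j. agree m n {j} c)"] by metis
    then obtain S where S: "finite S" "\<W> = (\<lambda>j. agree m n {j} c) ` S"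
      using finite_subset_image[OF \<W>(1,2)] by blast
    have "K \<subseteq> agree m n S c"
      using \<W>(3) unfolding S(2) by (auto simp: agree_def)
    then show ?thesis
      unfolding C_def using S(1) by blast
  qed
  have "C m n \<in> k_covers X" for m n
  proof -
    have "topspace X \<subseteq> \<Union>(C m n)"
      using compact[of "{x}" m n for x] by (meson UnionI compactin_sing insert_subset subsetI)
    moreover have "\<Union>(C m n) \<subseteq> topspace X"
      by (auto simp: C_def agree_def)
    ultimately show ?thesis
      using compact open_agree unfolding k_covers_def open_covers_def by (auto simp: C_def)
  qed
  then have "\<exists>B. (\<forall>n. B n \<in> C m n) \<and> range B \<in> open_covers X" for m
    using S1 unfolding S1_def by blast
  then obtain B where B: "\<And>m n. B m n \<in> C m n" "\<And>m. range (B m) \<in> open_covers X"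
    by metis
  have "\<exists>c. B m n \<subseteq> agree m n UNIV c" for m n
  proof -
    obtain S d where "B m n = agree m n S d"
      using B(1)[of m n] by (auto simp: C_def)
    then have "B m n \<subseteq> agree m n UNIV d"
      by (auto simp: agree_def)
    then show ?thesis
      by blast
  qed
  then obtain c where c: "\<And>m n. B m n \<subseteq> agree m n UNIV (c m n)"
    by metis
  define g where "g k = (case prod_decode k of (m, q) \<Rightarrow> case prod_decode q of (n, j) \<Rightarrow> c m n j)" for k
  have "infinite {n. v x n = g n}" if x: "x \<in> topspace X" for x
  proof
    assume fin: "finite {n. v x n = g n}"
    have "\<exists>n j. v x (e m n j) = g (e m n j)" for m
    proof -
      obtain n where "x \<in> B m n"
        using B(2)[of m] x by (auto simp: open_covers_def)
      then show ?thesis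
        using c[of m n] unfolding agree_def e_def g_def by fastforce
    qed
    then have "UNIV \<subseteq> (fst \<circ> prod_decode) ` {n. v x n = g n}"
      by (force simp: e_def image_iff)
    then show False
      using fin finite_surj infinite_UNIV_nat by blast
  qed
  then show ?thesis
    by (rule that)
qed

section \<open>The space\<close>

lemma homeomorphic_map_pullback_inv:
  assumes "inj_on i (topspace Y)"
  shows "homeomorphic_map Y (pullback_topology (i ` topspace Y) (inv_into (topspace Y) i) Y) i"
    (is "homeomorphic_map Y ?X i")
proof (rule bijective_open_imp_homeomorphic_map)
  have image: "i ` U = inv_into (topspace Y) i -` U \<inter> i ` topspace Y" if "U \<subseteq> topspace Y" for U
    using that assms by auto
  show top: "i ` topspace Y = topspace ?X"
    using assms by (auto simp: topspace_pullback_topology)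
  show "open_map Y ?X i"
    unfolding open_map_def openin_pullback_topology using image openin_subset by blast
  show "continuous_map Y ?X i"
    unfolding continuous_map
  proof (intro conjI allI impI)
    fix W assume "openin ?X W"
    then obtain U where "openin Y U" "W = inv_into (topspace Y) i -` U \<inter> i ` topspace Y"
      by (auto simp: openin_pullback_topology)
    moreover from this have "{x \<in> topspace Y. i x \<in> W} = U"
      using openin_subset[of Y U] inv_into_f_f[OF assms] by force
    ultimately show "openin Y {x \<in> topspace Y. i x \<in> W}"
      by simp
  qed (use top in simp)
qed (fact assms)

lemma second_countable_euclidean: "second_countable (euclidean :: 'a::second_countable_topology topology)"
proof -
  obtain \<B> :: "'a set set" where \<B>: "countable \<B>" "\<And>V. V \<in> \<B> \<Longrightarrow> open V"
    "\<And>U. open U \<Longrightarrow> \<exists>\<B>'. \<B>' \<subseteq> \<B> \<and> U = \<Union>\<B>'"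
    using univ_second_countable by blast
  have "\<exists>V\<in>\<B>. x \<in> V \<and> V \<subseteq> U" if "open U" "x \<in> U" for U x
    using \<B>(3)[OF that(1)] that(2) by blast
  then show ?thesis
    unfolding second_countable_def using \<B>(1,2) by (intro exI[of _ \<B>]) simp
qed

lemma Baire_space_separation:
  "regular_space (euclidean :: (nat \<Rightarrow> nat) topology)"
  "Hausdorff_space (euclidean :: (nat \<Rightarrow> nat) topology)"
proof -
  have "(euclidean :: nat topology) = discrete_topology UNIV"
    by (metis discrete_topology_unique open_discrete open_openin topspace_euclidean)
  then have "regular_space (euclidean :: nat topology)" "Hausdorff_space (euclidean :: nat topology)"
    by (simp_all add: metrizable_imp_regular_space metrizable_imp_Hausdorff_space
      metrizable_space_discrete_topology)
  then show "regular_space (euclidean :: (nat \<Rightarrow> nat) topology)"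
    "Hausdorff_space (euclidean :: (nat \<Rightarrow> nat) topology)"
    unfolding euclidean_product_topology[symmetric] regular_space_product_topology
      Hausdorff_space_product_topology by blast+
qed

lemma open_Baire_cylinder: "open {w :: nat \<Rightarrow> nat. w n = c}"
proof -
  have "open ((\<lambda>w :: nat \<Rightarrow> nat. w n) -` {c})"
    by (intro open_vimage continuous_on_product_coordinates) (rule open_discrete)
  then show ?thesis
    by (simp add: vimage_def)
qed

theorem mainTheorem3:
  assumes "cov_meager <o dominating_number"
  shows "\<exists>X :: real topology. regular_space X \<and> t1_space X \<and> Menger_space X \<and>
           \<not> S1 (k_covers X) (open_covers X)"
proof -
  obtain \<F> :: "real set set" where \<F>: "\<And>M. M \<in> \<F> \<Longrightarrow> meager M" "\<Union>\<F> = UNIV" "cov_meager = |\<F>|"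
  proof -
    define P where "P \<A> \<longleftrightarrow> (\<forall>M\<in>\<A>. meager M) \<and> \<Union>\<A> = UNIV" for \<A> :: "real set set"
    obtain \<C> where "P \<C>"
      using meager_cover_exists unfolding P_def by blast
    then obtain \<A> where "P \<A>" "least_card P = |\<A>|"
      using least_card(1) by blast
    then show ?thesis
      by (intro that[of \<A>]) (auto simp: P_def[abs_def] cov_meager_def)
  qed
  have small_\<F>: "|\<F>| <o dominating_number"
    using assms \<F>(3) by simp
  then obtain f :: "real set \<Rightarrow> nat \<Rightarrow> nat" where f: "\<And>g. \<exists>M\<in>\<F>. finite {k. f M k = g k}"
    using small_meager_cover_guessing[of \<F>] \<F>(1,2) by metis
  define F where "F = f ` \<F>"
  have small_F: "|F| <o dominating_number"
    unfolding F_def using card_of_image small_\<F> ordLeq_ordLess_trans by blast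
  obtain i :: "(nat \<Rightarrow> nat) \<Rightarrow> real" where i: "inj i"
    using nat_fun_lepoll_real unfolding lepoll_def by blast
  define Y where "Y = subtopology (euclidean :: (nat \<Rightarrow> nat) topology) F"
  have top_Y: "topspace Y = F"
    by (simp add: Y_def)
  define v where "v = inv_into F i"
  define X where "X = pullback_topology (i ` F) v Y"
  have hom: "homeomorphic_map Y X i"
    using homeomorphic_map_pullback_inv[of i Y] inj_on_subset[OF i, of F] by (simp add: X_def v_def top_Y)
  have Y: "regular_space Y" "Hausdorff_space Y" "second_countable Y"
    unfolding Y_def by (intro regular_space_subtopology Hausdorff_space_subtopology
      second_countable_subtopology Baire_space_separation second_countable_euclidean)+
  have X: "regular_space X" "Hausdorff_space X" "second_countable X" "topspace X = i ` F"
    using Y homeomorphic_map_imp_homeomorphic_space[OF hom] homeomorphic_regular_space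
      homeomorphic_Hausdorff_space homeomorphic_space_second_countability
      homeomorphic_imp_surjective_map[OF hom] top_Y by blast+
  have small_X: "|topspace X| <o dominating_number"
    unfolding X(4) using card_of_image small_F ordLeq_ordLess_trans by blast
  have "Menger_space X"
    using second_countable_imp_Lindelof_space[OF X(3)] small_X by (rule small_Lindelof_imp_Menger)
  moreover have "\<not> S1 (k_covers X) (open_covers X)"
  proof
    assume S1: "S1 (k_covers X) (open_covers X)"
    have countable: "countable K" if K: "compactin X K" for K
    proof (rule small_compact_imp_countable[OF X(3,2) K])
      show "\<not> (UNIV :: real set) \<lesssim> K"
      proof
        assume "(UNIV :: real set) \<lesssim> K"
        then have "(UNIV :: (nat \<Rightarrow> nat) set) \<lesssim> topspace X"
          using nat_fun_lepoll_real subset_imp_lepoll[OF compactin_subset_topspace[OF K]] lepoll_trans by blast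
        then have "|UNIV :: (nat \<Rightarrow> nat) set| \<le>o |topspace X|"
          unfolding lepoll_def card_of_ordLeq by blast
        then have "dominating_number \<le>o |topspace X|"
          using least_card(2)[where P = dominating, OF dominating_UNIV dominating_UNIV] ordLeq_transitive
          unfolding dominating_number_def by blast
        then show False
          using small_X not_ordLess_ordLeq by blast
      qed
    qed
    have opn: "openin X {x \<in> topspace X. v x n = c}" for n c
    proof -
      have "openin Y {w \<in> F. w n = c}"
        using open_Baire_cylinder[of n c] by (auto simp: Y_def openin_subtopology)
      then have "openin X (i ` {w \<in> F. w n = c})"
        using homeomorphic_imp_open_map[OF hom] by (simp add: open_map_def)
      also have "i ` {w \<in> F. w n = c} = {x \<in> topspace X. v x n = c}"
        using inj_on_subset[OF i, of F] by (auto simp: X(4) v_def)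
      finally show ?thesis .
    qed
    obtain g where g: "\<And>x. x \<in> topspace X \<Longrightarrow> infinite {n. v x n = g n}"
      using S1_imp_infinitely_often_equal[of X v, OF S1 countable opn] by blast
    obtain M where "M \<in> \<F>" "finite {k. f M k = g k}"
      using f by blast
    then show False
      using g[of "i (f M)"] inj_on_subset[OF i, of F] by (simp add: X(4) F_def v_def)
  qed
  ultimately show ?thesis
    using X(1,2) Hausdorff_imp_t1_space by blast
qed

end
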